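(* There are morphisms \[ \mathbf{Perm}\xrightarrow{\ \mathrm{can}\ }\mathbf{Rack}\xrightarrow{\ \mathrm{per}\ }\mathbf{Perm} \] of algebraic theories whose composition is the identity.
   Context: A rack $(R,\rhd)$ is a set $R$ with a binary operation $\rhd$ such that for every $x\in R$ the left multiplication $R\to R$, $y\mapsto x\rhd y$, is bijective and satisfies $x\rhd(y\rhd z)=(x\rhd y)\rhd(x\rhd z)$ for all $y,z\in R$; morphisms of racks are maps preserving $\rhd$. A permutation is a pair $(S,f)$ of a set $S$ and a bijection $f\colon S\to S$; a morphism $(S,f)\to(T,g)$ of permutations is a map $\phi\colon S\to T$ with $\phi f=g\phi$. $\mathbf{Perm}$ and $\mathbf{Rack}$ denote the algebraic theories (in the sense of Lawvere) of permutations and of racks, and also their categories of models. A morphism of algebraic theories $\mathbf{T}\to\mathbf{T}'$ is written in the direction of the left adjoint; it is the same as a ('forgetful', right-adjoint) functor from the category of $\mathbf{T}'$-models to the category of $\mathbf{T}$-models that commutes with the underlying-set functors. The symbols $\mathrm{can}$ and $\mathrm{per}$ are names for the two morphisms whose existence is asserted. *)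

theory Defs
  imports Main
begin

section \<open>Lawvere theories\<close>

text \<open>
  An algebraic theory is a category whose objects are the natural numbers, in which the object
  \<open>n\<close> is the \<open>n\<close>-th power of the object \<open>1\<close>. Hom-sets for different objects need not be disjoint,
  so composition carries its objects: \<open>Cmp T k m n g f\<close> is the composite of \<open>f : k \<rightarrow> m\<close> with
  \<open>g : m \<rightarrow> n\<close>. The power projections are part of the data (they amount to Lawvere's
  identity-on-objects, product-preserving functor from the opposite of the category of finite
  cardinals).
\<close>

record 'a lawvere =
  Hom :: "nat \<Rightarrow> nat \<Rightarrow> 'a set"
  Idn :: "nat \<Rightarrow> 'a"
  Cmp :: "nat \<Rightarrow> nat \<Rightarrow> nat \<Rightarrow> 'a \<Rightarrow> 'a \<Rightarrow> 'a"
  Prj :: "nat \<Rightarrow> nat \<Rightarrow> 'a"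

locale lawvere_theory =
  fixes T :: "'a lawvere"
  assumes Idn_in: "Idn T n \<in> Hom T n n"
    and Cmp_in: "\<lbrakk>f \<in> Hom T k m; g \<in> Hom T m n\<rbrakk> \<Longrightarrow> Cmp T k m n g f \<in> Hom T k n"
    and Idn_left: "f \<in> Hom T m n \<Longrightarrow> Cmp T m n n (Idn T n) f = f"
    and Idn_right: "f \<in> Hom T m n \<Longrightarrow> Cmp T m m n f (Idn T m) = f"
    and Cmp_assoc: "\<lbrakk>f \<in> Hom T j k; g \<in> Hom T k m; h \<in> Hom T m n\<rbrakk> \<Longrightarrow>
          Cmp T j m n h (Cmp T j k m g f) = Cmp T j k n (Cmp T k m n h g) f"
    and Prj_in: "i < n \<Longrightarrow> Prj T n i \<in> Hom T n 1"
    and Prj_one: "Prj T 1 0 = Idn T 1"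
    and power: "(\<And>i. i < n \<Longrightarrow> p i \<in> Hom T m 1) \<Longrightarrow>
          \<exists>!g. g \<in> Hom T m n \<and> (\<forall>i<n. Cmp T m n 1 (Prj T n i) g = p i)"

text \<open>Morphisms are the identity-on-objects functors that preserve the chosen powers.\<close>

locale lawvere_morphism = source: lawvere_theory S + target: lawvere_theory T
  for S :: "'a lawvere" and T :: "'b lawvere" +
  fixes F :: "nat \<Rightarrow> nat \<Rightarrow> 'a \<Rightarrow> 'b"
  assumes map_in: "f \<in> Hom S m n \<Longrightarrow> F m n f \<in> Hom T m n"
    and map_Idn: "F n n (Idn S n) = Idn T n"
    and map_Cmp: "\<lbrakk>f \<in> Hom S k m; g \<in> Hom S m n\<rbrakk> \<Longrightarrow>
          F k n (Cmp S k m n g f) = Cmp T k m n (F m n g) (F k m f)"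
    and map_Prj: "i < n \<Longrightarrow> F n 1 (Prj S n i) = Prj T n i"

definition id_morphism :: "nat \<Rightarrow> nat \<Rightarrow> 'a \<Rightarrow> 'a" where
  "id_morphism m n f = f"

definition comp_morphism ::
  "(nat \<Rightarrow> nat \<Rightarrow> 'b \<Rightarrow> 'c) \<Rightarrow> (nat \<Rightarrow> nat \<Rightarrow> 'a \<Rightarrow> 'b) \<Rightarrow> nat \<Rightarrow> nat \<Rightarrow> 'a \<Rightarrow> 'c" where
  "comp_morphism G F m n f = G m n (F m n f)"

text \<open>HOL functions also have values outside the hom-sets; these are irrelevant.\<close>

definition morphism_eq ::
  "'a lawvere \<Rightarrow> (nat \<Rightarrow> nat \<Rightarrow> 'a \<Rightarrow> 'b) \<Rightarrow> (nat \<Rightarrow> nat \<Rightarrow> 'a \<Rightarrow> 'b) \<Rightarrow> bool" where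
  "morphism_eq S F G \<longleftrightarrow> (\<forall>m n. \<forall>f \<in> Hom S m n. F m n f = G m n f)"


section \<open>The theory presented by operations and equations\<close>

datatype ('f, vars: 'v) trm = Var 'v | App 'f "('f, 'v) trm list"

primrec subst :: "('v \<Rightarrow> ('f, 'w) trm) \<Rightarrow> ('f, 'v) trm \<Rightarrow> ('f, 'w) trm" where
  "subst s (Var x) = s x"
| "subst s (App f ts) = App f (map (subst s) ts)"

primrec eval :: "('f \<Rightarrow> 'a list \<Rightarrow> 'a) \<Rightarrow> ('v \<Rightarrow> 'a) \<Rightarrow> ('f, 'v) trm \<Rightarrow> 'a" where
  "eval I v (Var x) = v x"
| "eval I v (App f ts) = I f (map (eval I v) ts)"

record 'f presentation =
  arity :: "'f \<Rightarrow> nat"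
  equations :: "(('f, nat) trm \<times> ('f, nat) trm) set"

inductive_set terms :: "'f presentation \<Rightarrow> nat \<Rightarrow> ('f, nat) trm set"
  for P :: "'f presentation" and m :: nat where
  terms_Var: "i < m \<Longrightarrow> Var i \<in> terms P m"
| terms_App: "\<lbrakk>length ts = arity P f; \<And>t. t \<in> set ts \<Longrightarrow> t \<in> terms P m\<rbrakk> \<Longrightarrow> App f ts \<in> terms P m"

text \<open>
  The least congruence on the terms in \<open>m\<close> variables containing all instances of the equations;
  the quotient is the free model on \<open>m\<close> generators. Instances only use terms in the same \<open>m\<close>
  variables, so the free model on no generators may be empty.
\<close>

inductive derivable :: "'f presentation \<Rightarrow> nat \<Rightarrow> ('f, nat) trm \<Rightarrow> ('f, nat) trm \<Rightarrow> bool"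
  for P :: "'f presentation" and m :: nat where
  derive_eq: "\<lbrakk>(l, r) \<in> equations P; \<And>x. x \<in> vars l \<union> vars r \<Longrightarrow> s x \<in> terms P m\<rbrakk> \<Longrightarrow>
    derivable P m (subst s l) (subst s r)"
| derive_refl: "t \<in> terms P m \<Longrightarrow> derivable P m t t"
| derive_sym: "derivable P m t u \<Longrightarrow> derivable P m u t"
| derive_trans: "\<lbrakk>derivable P m t u; derivable P m u w\<rbrakk> \<Longrightarrow> derivable P m t w"
| derive_cong: "\<lbrakk>length ts = arity P f; list_all2 (derivable P m) ts us\<rbrakk> \<Longrightarrow>
    derivable P m (App f ts) (App f us)"

definition term_class :: "'f presentation \<Rightarrow> nat \<Rightarrow> ('f, nat) trm \<Rightarrow> ('f, nat) trm set" where
  "term_class P m t = {u. derivable P m t u}"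

text \<open>
  A morphism \<open>m \<rightarrow> n\<close> is an \<open>n\<close>-tuple of \<open>m\<close>-ary operations, i.e. of elements of the free model on
  \<open>m\<close> generators. Composition is substitution of representatives.
\<close>

definition presented_theory :: "'f presentation \<Rightarrow> ('f, nat) trm set list lawvere" where
  "presented_theory P = \<lparr>
     Hom = (\<lambda>m n. {cs. length cs = n \<and> set cs \<subseteq> term_class P m ` terms P m}),
     Idn = (\<lambda>n. map (\<lambda>i. term_class P n (Var i)) [0..<n]),
     Cmp = (\<lambda>k m n cs ds. map (\<lambda>c. {u. \<exists>t \<in> c. \<exists>s. (\<forall>i<m. s i \<in> ds ! i) \<and>
              derivable P k (subst s t) u}) cs),
     Prj = (\<lambda>n i. [term_class P n (Var i)])\<rparr>"


section \<open>Permutations and racks\<close>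

datatype perm_op = Fwd | Bwd

definition perm_presentation :: "perm_op presentation" where
  "perm_presentation = \<lparr>
     arity = (\<lambda>_. 1),
     equations =
      (let x = Var 0; f = (\<lambda>t. App Fwd [t]); g = (\<lambda>t. App Bwd [t])
       in {(f (g x), x), (g (f x), x)})\<rparr>"

datatype rack_op = Act | InvAct

definition rack_presentation :: "rack_op presentation" where
  "rack_presentation = \<lparr>
     arity = (\<lambda>_. 2),
     equations =
      (let x = Var 0; y = Var 1; z = Var 2;
           a = (\<lambda>t u. App Act [t, u]); b = (\<lambda>t u. App InvAct [t, u])
       in {(a x (b x y), y), (b x (a x y), y), (a x (a y z), a (a x y) (a x z))})\<rparr>"

definition Perm :: "(perm_op, nat) trm set list lawvere" where
  "Perm = presented_theory perm_presentation"

definition Rack :: "(rack_op, nat) trm set list lawvere" where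
  "Rack = presented_theory rack_presentation"


subsection \<open>The models of the two presentations are the permutations and the racks\<close>

definition model :: "'f presentation \<Rightarrow> 'a set \<Rightarrow> ('f \<Rightarrow> 'a list \<Rightarrow> 'a) \<Rightarrow> bool" where
  "model P A I \<longleftrightarrow>
     (\<forall>f as. length as = arity P f \<and> set as \<subseteq> A \<longrightarrow> I f as \<in> A) \<and>
     (\<forall>(l, r) \<in> equations P. \<forall>v. (\<forall>x \<in> vars l \<union> vars r. v x \<in> A) \<longrightarrow> eval I v l = eval I v r)"

definition model_hom :: "'f presentation \<Rightarrow> 'a set \<Rightarrow> ('f \<Rightarrow> 'a list \<Rightarrow> 'a) \<Rightarrow>
    'b set \<Rightarrow> ('f \<Rightarrow> 'b list \<Rightarrow> 'b) \<Rightarrow> ('a \<Rightarrow> 'b) \<Rightarrow> bool" where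
  "model_hom P A I B J \<phi> \<longleftrightarrow> \<phi> ` A \<subseteq> B \<and>
     (\<forall>f as. length as = arity P f \<and> set as \<subseteq> A \<longrightarrow> \<phi> (I f as) = J f (map \<phi> as))"

definition permutation :: "'a set \<Rightarrow> ('a \<Rightarrow> 'a) \<Rightarrow> bool" where
  "permutation S f \<longleftrightarrow> bij_betw f S S"

definition permutation_hom ::
  "'a set \<Rightarrow> ('a \<Rightarrow> 'a) \<Rightarrow> 'b set \<Rightarrow> ('b \<Rightarrow> 'b) \<Rightarrow> ('a \<Rightarrow> 'b) \<Rightarrow> bool" where
  "permutation_hom S f T g \<phi> \<longleftrightarrow> \<phi> ` S \<subseteq> T \<and> (\<forall>x\<in>S. \<phi> (f x) = g (\<phi> x))"

definition rack :: "'a set \<Rightarrow> ('a \<Rightarrow> 'a \<Rightarrow> 'a) \<Rightarrow> bool" where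
  "rack R a \<longleftrightarrow> (\<forall>x\<in>R. bij_betw (a x) R R \<and> (\<forall>y\<in>R. \<forall>z\<in>R. a x (a y z) = a (a x y) (a x z)))"

definition rack_hom ::
  "'a set \<Rightarrow> ('a \<Rightarrow> 'a \<Rightarrow> 'a) \<Rightarrow> 'b set \<Rightarrow> ('b \<Rightarrow> 'b \<Rightarrow> 'b) \<Rightarrow> ('a \<Rightarrow> 'b) \<Rightarrow> bool" where
  "rack_hom R a Q b \<phi> \<longleftrightarrow> \<phi> ` R \<subseteq> Q \<and> (\<forall>x\<in>R. \<forall>y\<in>R. \<phi> (a x y) = b (\<phi> x) (\<phi> y))"

lemma all_list1: "(\<forall>as. length as = Suc 0 \<and> set as \<subseteq> A \<longrightarrow> P as) \<longleftrightarrow> (\<forall>x\<in>A. P [x])"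
  by (auto simp: length_Suc_conv)

lemma all_list2: "(\<forall>as. length as = 2 \<and> set as \<subseteq> A \<longrightarrow> P as) \<longleftrightarrow> (\<forall>x\<in>A. \<forall>y\<in>A. P [x, y])"
  by (auto simp: length_Suc_conv numeral_2_eq_2)

lemma all_perm_op: "(\<forall>f. P f) \<longleftrightarrow> P Fwd \<and> P Bwd"
proof (intro iffI allI)
  fix f assume "P Fwd \<and> P Bwd"
  then show "P f" by (cases f) simp_all
qed simp

lemma all_rack_op: "(\<forall>f. P f) \<longleftrightarrow> P Act \<and> P InvAct"
proof (intro iffI allI)
  fix f assume "P Act \<and> P InvAct"
  then show "P f" by (cases f) simp_all
qed simp

lemma model_perm_iff:
  "model perm_presentation S I \<longleftrightarrow>
     (\<forall>x\<in>S. I Fwd [x] \<in> S \<and> I Bwd [x] \<in> S \<and>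
       I Fwd [I Bwd [x]] = x \<and> I Bwd [I Fwd [x]] = x)"
    (is "_ \<longleftrightarrow> ?rhs")
proof -
  have "model perm_presentation S I \<longleftrightarrow>
     (\<forall>x\<in>S. I Fwd [x] \<in> S) \<and> (\<forall>x\<in>S. I Bwd [x] \<in> S) \<and>
     (\<forall>v::nat \<Rightarrow> 'a. v 0 \<in> S \<longrightarrow> I Fwd [I Bwd [v 0]] = v 0) \<and>
     (\<forall>v::nat \<Rightarrow> 'a. v 0 \<in> S \<longrightarrow> I Bwd [I Fwd [v 0]] = v 0)"
    unfolding model_def perm_presentation_def
    by (simp add: all_perm_op all_list1 Let_def conj_assoc)
  also have "\<dots> \<longleftrightarrow> (\<forall>x\<in>S. I Fwd [x] \<in> S) \<and> (\<forall>x\<in>S. I Bwd [x] \<in> S) \<and>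
     (\<forall>x. x \<in> S \<longrightarrow> I Fwd [I Bwd [x]] = x) \<and> (\<forall>x. x \<in> S \<longrightarrow> I Bwd [I Fwd [x]] = x)"
  proof -
    have "(\<forall>v::nat \<Rightarrow> 'a. P (v 0)) \<longleftrightarrow> (\<forall>x. P x)" for P
    proof (intro iffI allI)
      fix x assume "\<forall>v::nat \<Rightarrow> 'a. P (v 0)"
      from this[rule_format, of "\<lambda>_. x"] show "P x" .
    qed blast
    from this[of "\<lambda>x. x \<in> S \<longrightarrow> I Fwd [I Bwd [x]] = x"]
      this[of "\<lambda>x. x \<in> S \<longrightarrow> I Bwd [I Fwd [x]] = x"]
    show ?thesis by (simp only: simp_thms)
  qed
  also have "\<dots> \<longleftrightarrow> ?rhs"
    by blast
  finally show ?thesis .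
qed

lemma model_rack_iff:
  "model rack_presentation R I \<longleftrightarrow>
     (\<forall>x\<in>R. \<forall>y\<in>R. I Act [x, y] \<in> R \<and> I InvAct [x, y] \<in> R \<and>
       I Act [x, I InvAct [x, y]] = y \<and> I InvAct [x, I Act [x, y]] = y \<and>
       (\<forall>z\<in>R. I Act [x, I Act [y, z]] = I Act [I Act [x, y], I Act [x, z]]))"
    (is "_ \<longleftrightarrow> ?rhs")
proof -
  define E1 where "E1 = (\<lambda>x y. x \<in> R \<and> y \<in> R \<longrightarrow> I Act [x, I InvAct [x, y]] = y)"
  define E2 where "E2 = (\<lambda>x y. x \<in> R \<and> y \<in> R \<longrightarrow> I InvAct [x, I Act [x, y]] = y)"
  define E3 where "E3 = (\<lambda>x y z. x \<in> R \<and> y \<in> R \<and> z \<in> R \<longrightarrow>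
    I Act [x, I Act [y, z]] = I Act [I Act [x, y], I Act [x, z]])"
  have "model rack_presentation R I \<longleftrightarrow>
     (\<forall>x\<in>R. \<forall>y\<in>R. I Act [x, y] \<in> R) \<and> (\<forall>x\<in>R. \<forall>y\<in>R. I InvAct [x, y] \<in> R) \<and>
     (\<forall>v::nat \<Rightarrow> 'a. E1 (v 0) (v 1)) \<and> (\<forall>v::nat \<Rightarrow> 'a. E2 (v 0) (v 1)) \<and>
     (\<forall>v::nat \<Rightarrow> 'a. E3 (v 0) (v 1) (v 2))"
    unfolding model_def rack_presentation_def E1_def E2_def E3_def
    by (simp add: all_rack_op all_list2 Let_def conj_assoc)
      (simp only: conj_ac conj_absorb conj_left_absorb)
  also have "\<dots> \<longleftrightarrow> (\<forall>x\<in>R. \<forall>y\<in>R. I Act [x, y] \<in> R) \<and> (\<forall>x\<in>R. \<forall>y\<in>R. I InvAct [x, y] \<in> R) \<and>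
     (\<forall>x y. E1 x y) \<and> (\<forall>x y. E2 x y) \<and> (\<forall>x y z. E3 x y z)"
  proof -
    have "(\<forall>v::nat \<Rightarrow> 'a. P (v 0) (v 1) (v 2)) \<longleftrightarrow> (\<forall>x y z. P x y z)" for P
    proof (intro iffI allI)
      fix x y z assume "\<forall>v::nat \<Rightarrow> 'a. P (v 0) (v 1) (v 2)"
      from this[rule_format, of "\<lambda>i. if i = 0 then x else if i = 1 then y else z"]
      show "P x y z" by simp
    qed blast
    from this[of "\<lambda>x y z. E1 x y"] this[of "\<lambda>x y z. E2 x y"] this[of E3]
    show ?thesis by (simp only: simp_thms)
  qed
  also have "\<dots> \<longleftrightarrow> ?rhs"
  proof -
    have "(\<forall>x\<in>R. \<forall>y\<in>R. A x y) \<and> (\<forall>x\<in>R. \<forall>y\<in>R. B x y) \<and>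
        (\<forall>x y. x \<in> R \<and> y \<in> R \<longrightarrow> C x y) \<and> (\<forall>x y. x \<in> R \<and> y \<in> R \<longrightarrow> D x y) \<and>
        (\<forall>x y z. x \<in> R \<and> y \<in> R \<and> z \<in> R \<longrightarrow> F x y z) \<longleftrightarrow>
      (\<forall>x\<in>R. \<forall>y\<in>R. A x y \<and> B x y \<and> C x y \<and> D x y \<and> (\<forall>z\<in>R. F x y z))"
      for A B C D :: "'a \<Rightarrow> 'a \<Rightarrow> bool" and F
      by blast
    then show ?thesis unfolding E1_def E2_def E3_def .
  qed
  finally show ?thesis .
qed

lemma permutation_iff_model:
  "permutation S f \<longleftrightarrow> (\<exists>I. model perm_presentation S I \<and> (\<forall>x\<in>S. I Fwd [x] = f x))"
proof
  assume p: "permutation S f"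
  let ?I = "\<lambda>c as. case c of Fwd \<Rightarrow> f (hd as) | Bwd \<Rightarrow> inv_into S f (hd as)"
  have "model perm_presentation S ?I"
    using p unfolding model_perm_iff permutation_def
    by (auto simp: bij_betw_def inv_into_into f_inv_into_f)
  then show "\<exists>I. model perm_presentation S I \<and> (\<forall>x\<in>S. I Fwd [x] = f x)"
    by (intro exI[of _ ?I]) simp
next
  assume "\<exists>I. model perm_presentation S I \<and> (\<forall>x\<in>S. I Fwd [x] = f x)"
  then obtain I where m: "model perm_presentation S I"
    and e: "\<And>x. x \<in> S \<Longrightarrow> I Fwd [x] = f x" by blast
  note mm = m[unfolded model_perm_iff, rule_format]
  show "permutation S f"
    unfolding permutation_def
  proof (rule bij_betw_byWitness[where f' = "\<lambda>x. I Bwd [x]"])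
    show "\<forall>x\<in>S. I Bwd [f x] = x" "f ` S \<subseteq> S"
      using mm by (auto simp flip: e)
    show "\<forall>x\<in>S. f (I Bwd [x]) = x" "(\<lambda>x. I Bwd [x]) ` S \<subseteq> S"
      using mm by (auto simp flip: e)
  qed
qed

lemma rack_iff_model:
  "rack R a \<longleftrightarrow> (\<exists>I. model rack_presentation R I \<and> (\<forall>x\<in>R. \<forall>y\<in>R. I Act [x, y] = a x y))"
proof
  assume p: "rack R a"
  let ?I = "\<lambda>c as. case c of Act \<Rightarrow> a (hd as) (hd (tl as))
                   | InvAct \<Rightarrow> inv_into R (a (hd as)) (hd (tl as))"
  have "model rack_presentation R ?I"
    unfolding model_rack_iff
  proof (intro ballI conjI)
    fix x y assume xy: "x \<in> R" "y \<in> R"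
    then have b: "bij_betw (a x) R R"
      using p unfolding rack_def by blast
    show "?I Act [x, y] \<in> R" "?I InvAct [x, y] \<in> R"
      "?I Act [x, ?I InvAct [x, y]] = y" "?I InvAct [x, ?I Act [x, y]] = y"
      using b xy by (auto simp: bij_betw_def inv_into_into f_inv_into_f)
    fix z assume "z \<in> R"
    then have "a x (a y z) = a (a x y) (a x z)"
      using p xy unfolding rack_def by blast
    then show "?I Act [x, ?I Act [y, z]] = ?I Act [?I Act [x, y], ?I Act [x, z]]"
      by (simp only: rack_op.case list.sel)
  qed
  then show "\<exists>I. model rack_presentation R I \<and> (\<forall>x\<in>R. \<forall>y\<in>R. I Act [x, y] = a x y)"
    by (intro exI[of _ ?I]) simp
next
  assume "\<exists>I. model rack_presentation R I \<and> (\<forall>x\<in>R. \<forall>y\<in>R. I Act [x, y] = a x y)"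
  then obtain I where m: "model rack_presentation R I"
    and e: "\<And>x y. x \<in> R \<Longrightarrow> y \<in> R \<Longrightarrow> I Act [x, y] = a x y" by blast
  have inv: "I Act [x, y] \<in> R \<and> I InvAct [x, y] \<in> R \<and>
      I Act [x, I InvAct [x, y]] = y \<and> I InvAct [x, I Act [x, y]] = y"
    if "x \<in> R" "y \<in> R" for x y
    using m that unfolding model_rack_iff by blast
  have dist: "I Act [x, I Act [y, z]] = I Act [I Act [x, y], I Act [x, z]]"
    if "x \<in> R" "y \<in> R" "z \<in> R" for x y z
    using m that unfolding model_rack_iff by blast
  have closed: "a x y \<in> R" if "x \<in> R" "y \<in> R" for x y
    using inv[OF that] e[OF that] by simp
  show "rack R a"
    unfolding rack_def
  proof (intro ballI conjI)
    fix x assume x: "x \<in> R"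
    show "bij_betw (a x) R R"
    proof (rule bij_betw_byWitness[where f' = "\<lambda>y. I InvAct [x, y]"])
      show "\<forall>y\<in>R. I InvAct [x, a x y] = y" "a x ` R \<subseteq> R"
        using inv x by (auto simp flip: e)
      show "\<forall>y\<in>R. a x (I InvAct [x, y]) = y" "(\<lambda>y. I InvAct [x, y]) ` R \<subseteq> R"
        using inv x by (auto simp flip: e)
    qed
    fix y z assume "y \<in> R" "z \<in> R"
    then show "a x (a y z) = a (a x y) (a x z)"
      using dist[of x y z] x by (simp add: e closed)
  qed
qed

text \<open>
  The inverse operations are determined by the others and preserved by every morphism, so these
  correspondences are isomorphisms of categories over the category of sets.
\<close>

lemma model_hom_perm_iff:
  assumes "model perm_presentation S I" "model perm_presentation T J"
  shows "model_hom perm_presentation S I T J \<phi> \<longleftrightarrow>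
    permutation_hom S (\<lambda>x. I Fwd [x]) T (\<lambda>x. J Fwd [x]) \<phi>"
proof -
  have "\<phi> (I Bwd [x]) = J Bwd [\<phi> x]"
    if "\<phi> ` S \<subseteq> T" "\<forall>x\<in>S. \<phi> (I Fwd [x]) = J Fwd [\<phi> x]" "x \<in> S" for x
  proof -
    note I = assms(1)[unfolded model_perm_iff, rule_format]
      and J = assms(2)[unfolded model_perm_iff, rule_format]
    have "\<phi> (I Bwd [x]) = J Bwd [J Fwd [\<phi> (I Bwd [x])]]"
      using I J that by (simp add: image_subset_iff)
    also have "J Fwd [\<phi> (I Bwd [x])] = \<phi> (I Fwd [I Bwd [x]])"
      by (rule that(2)[rule_format, symmetric]) (simp add: I that)
    also have "I Fwd [I Bwd [x]] = x"
      using I that by simp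
    finally show ?thesis .
  qed
  then show ?thesis
    unfolding model_hom_def permutation_hom_def
    by (auto simp: perm_presentation_def all_perm_op all_list1)
qed

lemma model_hom_rack_iff:
  assumes "model rack_presentation R I" "model rack_presentation Q J"
  shows "model_hom rack_presentation R I Q J \<phi> \<longleftrightarrow>
    rack_hom R (\<lambda>x y. I Act [x, y]) Q (\<lambda>x y. J Act [x, y]) \<phi>"
proof -
  have "\<phi> (I InvAct [x, y]) = J InvAct [\<phi> x, \<phi> y]"
    if "\<phi> ` R \<subseteq> Q" "\<forall>x\<in>R. \<forall>y\<in>R. \<phi> (I Act [x, y]) = J Act [\<phi> x, \<phi> y]" "x \<in> R" "y \<in> R" for x y
  proof -
    have I: "I Act [x, y] \<in> R \<and> I InvAct [x, y] \<in> R \<and> I Act [x, I InvAct [x, y]] = y"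
      if "x \<in> R" "y \<in> R" for x y
      using assms(1) that unfolding model_rack_iff by blast
    have J: "J InvAct [x, J Act [x, y]] = y" if "x \<in> Q" "y \<in> Q" for x y
      using assms(2) that unfolding model_rack_iff by blast
    have "\<phi> (I InvAct [x, y]) = J InvAct [\<phi> x, J Act [\<phi> x, \<phi> (I InvAct [x, y])]]"
      using I J that by (simp add: image_subset_iff)
    also have "J Act [\<phi> x, \<phi> (I InvAct [x, y])] = \<phi> (I Act [x, I InvAct [x, y]])"
      by (rule that(2)[rule_format, symmetric]) (simp_all add: I that)
    also have "I Act [x, I InvAct [x, y]] = y"
      using I that by simp
    finally show ?thesis .
  qed
  then show ?thesis
    unfolding model_hom_def rack_hom_def
    by (auto simp: rack_presentation_def all_rack_op all_list2)
qed

end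

theory Submission
  imports Defs
begin

text \<open>
  The map \<open>x \<mapsto> x \<rhd> x\<close> on a rack is a bijection with inverse \<open>x \<mapsto> y = x \<rhd>\<inverse> x\<close>: since
  \<open>x \<rhd> y = x\<close>, self-distributivity gives \<open>x \<rhd> (y \<rhd> y) = x \<rhd> x\<close>, hence \<open>y \<rhd> y = x\<close>, and
  \<open>x \<rhd> x = x \<rhd> (x \<rhd> y) = (x \<rhd> x) \<rhd> x\<close>, hence \<open>(x \<rhd> x) \<rhd>\<inverse> (x \<rhd> x) = x\<close>. This gives \<open>can\<close>. Conversely every permutation \<open>f\<close> defines a rack by \<open>x \<rhd> y = f y\<close>; this
  gives \<open>per\<close>. In the rack of a permutation \<open>x \<rhd> x = f x\<close>, so the composite is the identity.
\<close>

section \<open>Terms and substitution\<close>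

lemma terms_Var_iff [simp]: "Var i \<in> terms P m \<longleftrightarrow> i < m"
  by (auto elim: terms.cases intro: terms.intros)

lemma terms_App_iff [simp]:
  "App f ts \<in> terms P m \<longleftrightarrow> length ts = arity P f \<and> set ts \<subseteq> terms P m"
  by (auto elim: terms.cases intro: terms.intros)

lemma subst_subst: "subst s (subst r t) = subst (\<lambda>x. subst s (r x)) t"
  by (induction t) auto

lemma subst_cong: "(\<And>x. x \<in> vars t \<Longrightarrow> s x = r x) \<Longrightarrow> subst s t = subst r t"
  by (induction t) auto

lemma vars_terms: "t \<in> terms P m \<Longrightarrow> x \<in> vars t \<Longrightarrow> x < m"
  by (induction rule: terms.induct) auto

lemma subst_terms:
  "t \<in> terms P m \<Longrightarrow> (\<And>x. x \<in> vars t \<Longrightarrow> s x \<in> terms P k) \<Longrightarrow> subst s t \<in> terms P k"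
  by (induction rule: terms.induct) auto

text \<open>\<open>(!) us\<close> is unspecified from \<open>length us\<close> on, but the variables
  of \<open>t\<close> all lie below \<open>m\<close>.\<close>

lemma subst_nth_terms:
  assumes "t \<in> terms P m" "length us = m" "set us \<subseteq> terms P k"
  shows "subst ((!) us) t \<in> terms P k"
  using assms by (intro subst_terms) (auto dest!: vars_terms)

lemma derivable_subst_cong:
  assumes "t \<in> terms P m" and "\<And>i. i < m \<Longrightarrow> derivable P k (s i) (r i)"
  shows "derivable P k (subst s t) (subst r t)"
  using assms
proof (induction rule: terms.induct)
  case (terms_App ts f)
  then show ?case
    by (auto intro!: derive_cong simp: list_all2_conv_all_nth)
qed simp


section \<open>The theory of a presentation\<close>

text \<open>Raw terms are not checked against \<open>arity\<close>; this excludes equations with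
  miscounted arguments, whose instances would fall outside \<open>terms\<close>. The bound
  \<open>k\<close> may vary with the equation.\<close>

locale wf_presentation =
  fixes P :: "'f presentation"
  assumes equation_terms: "(l, r) \<in> equations P \<Longrightarrow> \<exists>k. l \<in> terms P k \<and> r \<in> terms P k"
begin

lemma derivable_terms: "derivable P m t u \<Longrightarrow> t \<in> terms P m \<and> u \<in> terms P m"
proof (induction rule: derivable.induct)
  case (derive_eq l r s)
  then show ?case by (meson UnCI equation_terms subst_terms)
next
  case (derive_cong ts f us)
  then show ?case
    by (auto simp: list_all2_conv_all_nth in_set_conv_nth)
qed auto

lemma derivable_subst:
  assumes "derivable P m t u" and s: "\<And>i. i < m \<Longrightarrow> s i \<in> terms P k"
  shows "derivable P k (subst s t) (subst s u)"
  using assms(1)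
proof (induction rule: derivable.induct)
  case (derive_eq l r s')
  \<comment> \<open>Substituting \<open>s\<close> into the instance under \<open>s'\<close> gives
    the instance under the composite substitution.\<close>
  have "derivable P k (subst (\<lambda>x. subst s (s' x)) l) (subst (\<lambda>x. subst s (s' x)) r)"
    using derive_eq s vars_terms by (intro derivable.derive_eq) (blast intro: subst_terms)+
  then show ?case by (simp add: subst_subst)
next
  case (derive_refl t)
  then show ?case by (blast intro: derivable.derive_refl subst_terms s dest: vars_terms)
next
  case (derive_sym t u)
  from derive_sym.IH show ?case by (rule derivable.derive_sym)
next
  case (derive_trans t u w)
  from derive_trans.IH show ?case by (rule derivable.derive_trans)
next
  case (derive_cong ts f us)
  then show ?case
    by (auto intro!: derivable.derive_cong simp: list_all2_conv_all_nth)
qed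

text \<open>First the term is replaced, then the substitution. This makes composition independent of
  representatives.\<close>

lemma derivable_subst_both:
  assumes "derivable P m t u" and "\<And>i. i < m \<Longrightarrow> derivable P k (s i) (r i)"
  shows "derivable P k (subst s t) (subst r u)"
proof (rule derive_trans)
  show "derivable P k (subst s t) (subst s u)"
    using assms derivable_terms by (intro derivable_subst) auto
  show "derivable P k (subst s u) (subst r u)"
    using assms derivable_terms[OF assms(1)] by (intro derivable_subst_cong) auto
qed

section \<open>Morphisms of the presented theory through tuples of representatives\<close>

lemma Hom_presented:
  "Hom (presented_theory P) m n =
     {map (term_class P m) ts | ts. length ts = n \<and> set ts \<subseteq> terms P m}"
proof -
  have "(set cs \<subseteq> term_class P m ` terms P m) =
      (\<exists>ts. cs = map (term_class P m) ts \<and> set ts \<subseteq> terms P m)" for cs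
    using ex_map_conv[of cs "term_class P m"] lists_image[of "term_class P m" "terms P m"]
    by (auto simp: lists_eq_set)
  then show ?thesis by (auto simp: presented_theory_def)
qed

text \<open>\<open>Cmp\<close> collects the results of all choices of representatives; by
  \<open>derivable_subst_both\<close> they form a single class.\<close>

lemma Cmp_presented:
  assumes "length us = m" "set us \<subseteq> terms P k" "set ts \<subseteq> terms P m"
  shows "Cmp (presented_theory P) k m n (map (term_class P m) ts) (map (term_class P k) us) =
    map (\<lambda>t. term_class P k (subst ((!) us) t)) ts"
proof -
  have "{w. \<exists>t' \<in> term_class P m t. \<exists>s. (\<forall>i<m. s i \<in> map (term_class P k) us ! i) \<and>
      derivable P k (subst s t') w} = term_class P k (subst ((!) us) t)" (is "?A = ?B")
    if "t \<in> terms P m" for t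
  proof
    show "?A \<subseteq> ?B"
    proof
      fix w assume "w \<in> ?A"
      then obtain t' s where t': "derivable P m t t'"
        and s: "\<And>i. i < m \<Longrightarrow> derivable P k (us ! i) (s i)"
        and w: "derivable P k (subst s t') w"
        using assms(1) by (auto simp: term_class_def)
      have "derivable P k (subst ((!) us) t) (subst s t')"
        using derivable_subst_both[OF t' s] .
      then show "w \<in> ?B"
        using w by (auto simp: term_class_def intro: derive_trans)
    qed
    \<comment> \<open>For the other inclusion, \<open>t\<close> and the \<open>us ! i\<close>
      themselves serve as representatives.\<close>
    have "us ! i \<in> term_class P k (us ! i)" if "i < m" for i
      using that assms nth_mem[of i us] by (auto simp: term_class_def intro!: derive_refl)
    then show "?B \<subseteq> ?A"
      using that assms(1) by (auto simp: term_class_def intro!: derive_refl)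
  qed
  then show ?thesis using assms(3) by (auto simp: presented_theory_def)
qed

lemma Idn_presented: "Idn (presented_theory P) n = map (term_class P n) (map Var [0..<n])"
  by (simp add: presented_theory_def)

lemma Prj_presented: "Prj (presented_theory P) n i = map (term_class P n) [Var i]"
  by (simp add: presented_theory_def)

text \<open>Substituting into \<open>Var i\<close> reads off component \<open>i\<close>; existence
  and uniqueness in the power property both rest on this.\<close>

lemma Cmp_Prj:
  assumes "g \<in> Hom (presented_theory P) m n" "i < n"
  shows "Cmp (presented_theory P) m n 1 (Prj (presented_theory P) n i) g = [g ! i]"
proof -
  obtain ts where g: "g = map (term_class P m) ts" and "length ts = n" "set ts \<subseteq> terms P m"
    using assms(1) unfolding Hom_presented by blast
  then show ?thesis
    unfolding g Prj_presented using assms(2) by (subst Cmp_presented) auto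
qed

theorem lawvere_theory_presented: "lawvere_theory (presented_theory P)"
proof
  let ?T = "presented_theory P"
  fix n :: nat
  show "Idn ?T n \<in> Hom ?T n n"
    by (auto simp: presented_theory_def)
  show "Prj ?T 1 0 = Idn ?T 1"
    by (simp add: presented_theory_def)
  show "Prj ?T n i \<in> Hom ?T n 1" if "i < n" for i
    using that by (auto simp: presented_theory_def)
next
  let ?T = "presented_theory P"
  fix f g k m n assume "f \<in> Hom ?T k m" "g \<in> Hom ?T m n"
  then obtain us ts where "f = map (term_class P k) us" "g = map (term_class P m) ts"
    and len: "length us = m" "length ts = n" and sub: "set us \<subseteq> terms P k" "set ts \<subseteq> terms P m"
    unfolding Hom_presented by blast
  then have "Cmp ?T k m n g f = map (term_class P k) (map (subst ((!) us)) ts)"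
    by (simp add: Cmp_presented)
  moreover have "set (map (subst ((!) us)) ts) \<subseteq> terms P k"
    using len sub by (auto intro!: subst_nth_terms)
  ultimately show "Cmp ?T k m n g f \<in> Hom ?T k n"
    unfolding Hom_presented using len by (metis (mono_tags, lifting) length_map mem_Collect_eq)
next
  let ?T = "presented_theory P"
  fix f m n assume "f \<in> Hom ?T m n"
  then obtain ts where f: "f = map (term_class P m) ts" "length ts = n" "set ts \<subseteq> terms P m"
    unfolding Hom_presented by blast
  show "Cmp ?T m n n (Idn ?T n) f = f"
    unfolding f(1) Idn_presented using f(2,3)
    by (subst Cmp_presented) (auto intro!: nth_equalityI)
  have "subst ((!) (map Var [0..<m])) t = t" if "t \<in> terms P m" for t :: "('f, nat) trm"
    using that by (induction rule: terms.induct) (auto intro: map_idI)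
  then show "Cmp ?T m m n f (Idn ?T m) = f"
    unfolding f(1) Idn_presented using f(2,3)
    by (subst Cmp_presented) auto
next
  let ?T = "presented_theory P"
  fix f g h j k m n assume "f \<in> Hom ?T j k" "g \<in> Hom ?T k m" "h \<in> Hom ?T m n"
  then obtain us ts ws where eqs: "f = map (term_class P j) us" "g = map (term_class P k) ts"
      "h = map (term_class P m) ws"
    and len: "length us = k" "length ts = m" "length ws = n"
    and sub: "set us \<subseteq> terms P j" "set ts \<subseteq> terms P k" "set ws \<subseteq> terms P m"
    unfolding Hom_presented by blast
  have gf: "Cmp ?T j k m g f = map (term_class P j) (map (subst ((!) us)) ts)"
    and hg: "Cmp ?T k m n h g = map (term_class P k) (map (subst ((!) ts)) ws)"
    using len sub by (simp_all add: eqs Cmp_presented)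
  have sub': "set (map (subst ((!) us)) ts) \<subseteq> terms P j"
      "set (map (subst ((!) ts)) ws) \<subseteq> terms P k"
    using len sub by (auto intro!: subst_nth_terms)
  \<comment> \<open>Associativity is \<open>subst_subst\<close>, once the two substitutions agree on
    the variables of \<open>w\<close>, which lie below \<open>m\<close>.\<close>
  have "subst ((!) (map (subst ((!) us)) ts)) w = subst ((!) us) (subst ((!) ts) w)"
    if "w \<in> set ws" for w
    unfolding subst_subst using len sub that by (intro subst_cong) (auto dest!: vars_terms)
  then show "Cmp ?T j m n h (Cmp ?T j k m g f) = Cmp ?T j k n (Cmp ?T k m n h g) f"
    unfolding gf hg unfolding eqs using len sub sub'
    by (simp add: Cmp_presented del: map_map set_map) simp
next
  let ?T = "presented_theory P"
  fix n m and p :: "nat \<Rightarrow> ('f, nat) trm set list"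
  assume p: "\<And>i. i < n \<Longrightarrow> p i \<in> Hom ?T m 1"
  \<comment> \<open>Each \<open>p i\<close> is a one-element list; its head is the component that
    \<open>Cmp_Prj\<close> dictates.\<close>
  let ?g = "map (\<lambda>i. hd (p i)) [0..<n]"
  have p1: "p i = [hd (p i)] \<and> hd (p i) \<in> term_class P m ` terms P m" if "i < n" for i
    using p[OF that] by (auto simp: presented_theory_def length_Suc_conv)
  have g: "?g \<in> Hom ?T m n"
    using p1 by (auto simp: presented_theory_def)
  show "\<exists>!g. g \<in> Hom ?T m n \<and> (\<forall>i<n. Cmp ?T m n 1 (Prj ?T n i) g = p i)"
  proof (intro ex1I[of _ ?g] conjI allI impI)
    show "Cmp ?T m n 1 (Prj ?T n i) ?g = p i" if "i < n" for i
      using Cmp_Prj[OF g that] p1[OF that] that by simp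
  next
    fix g assume "g \<in> Hom ?T m n \<and> (\<forall>i<n. Cmp ?T m n 1 (Prj ?T n i) g = p i)"
    then have g': "g \<in> Hom ?T m n" and pr: "\<And>i. i < n \<Longrightarrow> p i = [g ! i]"
      using Cmp_Prj by auto
    from g' have "length g = n"
      by (simp add: presented_theory_def)
    then show "g = ?g"
      by (intro nth_equalityI) (simp_all add: pr)
  qed (rule g)
qed

end


section \<open>Translations of presentations\<close>

text \<open>The homomorphic extension of \<open>Var\<close>, where target terms carry the source
  operations through \<open>\<tau>\<close>: the arguments replace the variables of
  \<open>\<tau> f\<close>.\<close>

definition translate ::
  "('f \<Rightarrow> ('g, nat) trm) \<Rightarrow> ('f, nat) trm \<Rightarrow> ('g, nat) trm" where
  "translate \<tau> = eval (\<lambda>f ts. subst ((!) ts) (\<tau> f)) Var"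

lemma translate_simps [simp]:
  "translate \<tau> (Var i) = Var i"
  "translate \<tau> (App f ts) = subst ((!) (map (translate \<tau>) ts)) (\<tau> f)"
  by (simp_all add: translate_def)

text \<open>Every member of a class is translated and the result closed under derivability, so that
  no representative has to be chosen.\<close>

definition translation_morphism ::
  "'g presentation \<Rightarrow> ('f \<Rightarrow> ('g, nat) trm) \<Rightarrow>
    nat \<Rightarrow> nat \<Rightarrow> ('f, nat) trm set list \<Rightarrow> ('g, nat) trm set list" where
  "translation_morphism Q \<tau> m n = map (\<lambda>c. {u. \<exists>t \<in> c. derivable Q m (translate \<tau> t) u})"

text \<open>
  The equations are required for all instances, not just for the variables themselves: an instance
  in \<open>m\<close> variables only constrains \<open>s\<close> on the variables that occur, and when there are no terms
  in \<open>m\<close> variables, \<open>s\<close> cannot be extended to the others.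
\<close>

locale translation = source: wf_presentation P + target: wf_presentation Q
  for P :: "'f presentation" and Q :: "'g presentation" +
  fixes \<tau> :: "'f \<Rightarrow> ('g, nat) trm"
  assumes operation_terms: "\<tau> f \<in> terms Q (arity P f)"
    and equation_derivable: "\<lbrakk>(l, r) \<in> equations P; \<And>x. x \<in> vars l \<union> vars r \<Longrightarrow> s x \<in> terms Q m\<rbrakk> \<Longrightarrow>
      derivable Q m (subst s (translate \<tau> l)) (subst s (translate \<tau> r))"
begin

lemma translate_terms: "t \<in> terms P m \<Longrightarrow> translate \<tau> t \<in> terms Q m"
proof (induction rule: terms.induct)
  case (terms_App ts f)
  then show ?case
    using vars_terms[OF operation_terms] by (auto intro!: subst_terms[OF operation_terms])
qed simp

text \<open>In the application case both sides substitute into \<open>\<tau> f\<close>, whose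
  variables lie below the arity, so that \<open>map\<close> and \<open>!\<close> commute
  there.\<close>

lemma translate_subst:
  "t \<in> terms P m \<Longrightarrow> translate \<tau> (subst s t) = subst (\<lambda>x. translate \<tau> (s x)) (translate \<tau> t)"
proof (induction rule: terms.induct)
  case (terms_App ts f)
  then show ?case
    using vars_terms[OF operation_terms] by (auto simp: subst_subst intro!: subst_cong)
qed simp

text \<open>An instance under \<open>s\<close> becomes an instance of the translated equation under
  the translates of \<open>s\<close>, which \<open>equation_derivable\<close> covers. In the
  congruence case the arguments enter \<open>\<tau> f\<close> by substitution.\<close>

lemma translate_derivable:
  "derivable P m t u \<Longrightarrow> derivable Q m (translate \<tau> t) (translate \<tau> u)"
proof (induction rule: derivable.induct)
  case (derive_eq l r s)
  obtain k where "l \<in> terms P k" "r \<in> terms P k"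
    using source.equation_terms derive_eq(1) by blast
  then show ?case
    using derive_eq by (auto simp: translate_subst intro!: equation_derivable translate_terms)
next
  case (derive_cong ts f us)
  then show ?case
    by (auto simp: list_all2_conv_all_nth intro!: derivable_subst_cong[OF operation_terms])
qed (auto intro: translate_terms derive_refl derive_sym derive_trans)

lemma translation_morphism_map:
  assumes "set ts \<subseteq> terms P m"
  shows "translation_morphism Q \<tau> m n (map (term_class P m) ts) =
    map (term_class Q m) (map (translate \<tau>) ts)"
proof -
  have "{u. \<exists>t' \<in> term_class P m t. derivable Q m (translate \<tau> t') u} =
      term_class Q m (translate \<tau> t)" if "t \<in> terms P m" for t
    using that unfolding term_class_def
    by (blast intro: derive_refl derive_trans translate_derivable)
  then show ?thesis
    using assms by (auto simp: translation_morphism_def)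
qed

text \<open>On representatives the functor is \<open>translate\<close> in each component: it fixes
  variables, hence identities and projections, and respects composition by
  \<open>translate_subst\<close>.\<close>

theorem lawvere_morphism_translation:
  "lawvere_morphism (presented_theory P) (presented_theory Q) (translation_morphism Q \<tau>)"
proof (intro lawvere_morphism.intro lawvere_morphism_axioms.intro
    source.lawvere_theory_presented target.lawvere_theory_presented)
  let ?S = "presented_theory P" and ?T = "presented_theory Q" and ?F = "translation_morphism Q \<tau>"
  show "?F m n f \<in> Hom ?T m n" if f: "f \<in> Hom ?S m n" for f m n
  proof -
    obtain ts where "f = map (term_class P m) ts" "length ts = n" "set ts \<subseteq> terms P m"
      using f unfolding source.Hom_presented by blast
    then show ?thesis
      unfolding target.Hom_presented
      by (intro CollectI exI[of _ "map (translate \<tau>) ts"])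
        (auto simp: translation_morphism_map translate_terms subset_iff)
  qed
  show "?F n n (Idn ?S n) = Idn ?T n" for n
    unfolding source.Idn_presented target.Idn_presented
    by (subst translation_morphism_map) auto
  show "?F n 1 (Prj ?S n i) = Prj ?T n i" if "i < n" for i n
    unfolding source.Prj_presented target.Prj_presented using that
    by (subst translation_morphism_map) auto
  show "?F k n (Cmp ?S k m n g f) = Cmp ?T k m n (?F m n g) (?F k m f)"
    if fg: "f \<in> Hom ?S k m" "g \<in> Hom ?S m n" for f g k m n
  proof -
    obtain us ts where eqs: "f = map (term_class P k) us" "g = map (term_class P m) ts"
      and len: "length us = m" and sub: "set us \<subseteq> terms P k" "set ts \<subseteq> terms P m"
      using fg unfolding source.Hom_presented by blast
    have "Cmp ?S k m n g f = map (term_class P k) (map (subst ((!) us)) ts)"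
      using len sub by (simp add: eqs source.Cmp_presented)
    moreover have "set (map (subst ((!) us)) ts) \<subseteq> terms P k"
      using len sub by (auto intro!: subst_nth_terms)
    ultimately have "?F k n (Cmp ?S k m n g f) =
        map (\<lambda>t. term_class Q k (translate \<tau> (subst ((!) us) t))) ts"
      by (simp only: translation_morphism_map) simp
    also have "\<dots> = map (\<lambda>t. term_class Q k
        (subst ((!) (map (translate \<tau>) us)) (translate \<tau> t))) ts"
    proof (intro map_cong refl arg_cong[of _ _ "term_class Q k"])
      fix t assume "t \<in> set ts"
      then have t: "t \<in> terms P m" using sub by blast
      show "translate \<tau> (subst ((!) us) t) = subst ((!) (map (translate \<tau>) us)) (translate \<tau> t)"
        unfolding translate_subst[OF t] using vars_terms[OF translate_terms[OF t]] len
        by (intro subst_cong) simp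
    qed
    also have "\<dots> = Cmp ?T k m n (?F m n g) (?F k m f)"
      unfolding eqs translation_morphism_map[OF sub(1)] translation_morphism_map[OF sub(2)]
      using len sub by (subst target.Cmp_presented) (auto intro: translate_terms)
    finally show ?thesis .
  qed
qed

end

text \<open>Since both morphisms act on representatives, an equality of raw terms passes to classes.
  It is one-sided: \<open>\<sigma>\<close> undoes \<open>\<tau>\<close>.\<close>

lemma translation_morphism_inverse:
  assumes "translation P Q \<tau>" "translation Q P \<sigma>"
    and inverse: "\<And>m t. t \<in> terms P m \<Longrightarrow> translate \<sigma> (translate \<tau> t) = t"
  shows "morphism_eq (presented_theory P)
    (comp_morphism (translation_morphism P \<sigma>) (translation_morphism Q \<tau>)) id_morphism"
  unfolding morphism_eq_def
proof (intro allI ballI)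
  interpret A: translation P Q \<tau> by fact
  interpret B: translation Q P \<sigma> by fact
  fix m n f assume "f \<in> Hom (presented_theory P) m n"
  then obtain ts where f: "f = map (term_class P m) ts" and sub: "set ts \<subseteq> terms P m"
    unfolding A.source.Hom_presented by blast
  have "set (map (translate \<tau>) ts) \<subseteq> terms Q m"
    using sub by (auto intro: A.translate_terms)
  then have "comp_morphism (translation_morphism P \<sigma>) (translation_morphism Q \<tau>) m n f =
      map (term_class P m) (map (translate \<sigma>) (map (translate \<tau>) ts))"
    by (simp only: comp_morphism_def f A.translation_morphism_map[OF sub]
        B.translation_morphism_map)
  also have "\<dots> = id_morphism m n f"
    using sub inverse by (auto simp: id_morphism_def f)
  finally show "comp_morphism (translation_morphism P \<sigma>) (translation_morphism Q \<tau>) m n f =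
    id_morphism m n f" .
qed


section \<open>Permutations and racks\<close>

lemma arity_perm [simp]: "arity perm_presentation f = Suc 0"
  by (simp add: perm_presentation_def)

lemma arity_rack [simp]: "arity rack_presentation f = 2"
  by (simp add: rack_presentation_def)

interpretation perm: wf_presentation perm_presentation
proof
  fix l r assume "(l, r) \<in> equations perm_presentation"
  then have "l \<in> terms perm_presentation 1 \<and> r \<in> terms perm_presentation 1"
    by (subst (asm) perm_presentation_def) (auto simp: Let_def)
  then show "\<exists>k. l \<in> terms perm_presentation k \<and> r \<in> terms perm_presentation k" ..
qed

interpretation rack: wf_presentation rack_presentation
proof
  fix l r assume "(l, r) \<in> equations rack_presentation"
  \<comment> \<open>Self-distributivity involves three variables.\<close>
  then have "l \<in> terms rack_presentation 3 \<and> r \<in> terms rack_presentation 3"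
    by (subst (asm) rack_presentation_def) (auto simp: Let_def)
  then show "\<exists>k. l \<in> terms rack_presentation k \<and> r \<in> terms rack_presentation k" ..
qed

section \<open>Derived equations of permutations and racks\<close>

lemma perm_derivable:
  assumes "t \<in> terms perm_presentation m"
  shows "derivable perm_presentation m (App Fwd [App Bwd [t]]) t"
    and "derivable perm_presentation m (App Bwd [App Fwd [t]]) t"
proof -
  \<comment> \<open>Only \<open>Var 0\<close> occurs in the equations, so a constant substitution
    yields the instance at \<open>t\<close>.\<close>
  have "derivable perm_presentation m (subst (\<lambda>_. t) l) (subst (\<lambda>_. t) r)"
    if "(l, r) \<in> equations perm_presentation" for l r
    using that assms by (rule derive_eq)
  from this[of "App Fwd [App Bwd [Var 0]]" "Var 0"] this[of "App Bwd [App Fwd [Var 0]]" "Var 0"]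
  show "derivable perm_presentation m (App Fwd [App Bwd [t]]) t"
    "derivable perm_presentation m (App Bwd [App Fwd [t]]) t"
    by (simp_all add: perm_presentation_def Let_def)
qed

lemma rack_derivable:
  assumes "t \<in> terms rack_presentation m" "u \<in> terms rack_presentation m"
  shows "derivable rack_presentation m (App Act [t, App InvAct [t, u]]) u"
    and "derivable rack_presentation m (App InvAct [t, App Act [t, u]]) u"
    and "w \<in> terms rack_presentation m \<Longrightarrow> derivable rack_presentation m
      (App Act [t, App Act [u, w]]) (App Act [App Act [t, u], App Act [t, w]])"
proof -
  have *: "derivable rack_presentation m
      (subst (\<lambda>i. if i = 0 then t else if i = 1 then u else w) l)
      (subst (\<lambda>i. if i = 0 then t else if i = 1 then u else w) r)"
    if "(l, r) \<in> equations rack_presentation" "w \<in> terms rack_presentation m" for l r w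
    using that assms by (intro derive_eq) auto
  \<comment> \<open>The fact \<open>*\<close> asks for a value at \<open>Var 2\<close>; in the two
    inverse laws \<open>u\<close> is the filler.\<close>
  show "derivable rack_presentation m (App Act [t, App InvAct [t, u]]) u"
    using *[of "App Act [Var 0, App InvAct [Var 0, Var 1]]" "Var 1" u] assms
    by (simp add: rack_presentation_def Let_def)
  show "derivable rack_presentation m (App InvAct [t, App Act [t, u]]) u"
    using *[of "App InvAct [Var 0, App Act [Var 0, Var 1]]" "Var 1" u] assms
    by (simp add: rack_presentation_def Let_def)
  show "derivable rack_presentation m
      (App Act [t, App Act [u, w]]) (App Act [App Act [t, u], App Act [t, w]])"
    if "w \<in> terms rack_presentation m"
    using *[of "App Act [Var 0, App Act [Var 1, Var 2]]"
        "App Act [App Act [Var 0, Var 1], App Act [Var 0, Var 2]]" w] that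
    by (simp add: rack_presentation_def Let_def)
qed

lemma rack_cong:
  assumes "derivable rack_presentation m t t'" "derivable rack_presentation m u u'"
  shows "derivable rack_presentation m (App f [t, u]) (App f [t', u'])"
  using assms by (intro derive_cong) auto

text \<open>These are the permutation equations for the square map, carried out inside the
  congruence: an equation used below an operation passes through \<open>rack_cong\<close>.\<close>

lemma rack_square_inverse:
  assumes t: "t \<in> terms rack_presentation m"
  shows "derivable rack_presentation m
      (App Act [App InvAct [t, t], App InvAct [t, t]]) t" (is ?left)
    and "derivable rack_presentation m
      (App InvAct [App Act [t, t], App Act [t, t]]) t" (is ?right)
proof -
  let ?y = "App InvAct [t, t]" and ?z = "App Act [t, t]"
  note [trans] = derive_trans[of rack_presentation m]
  note D = rack_derivable[of _ m]
  have refl: "derivable rack_presentation m t t"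
    using t by (rule derive_refl)
  have y: "?y \<in> terms rack_presentation m" and z: "?z \<in> terms rack_presentation m"
    using t by auto
  have ty: "derivable rack_presentation m (App Act [t, ?y]) t"
    using D(1) t t .
  \<comment> \<open>Acting by \<open>t\<close> and then by its inverse brings in an outer
    \<open>t\<close> to distribute over the square of \<open>?y\<close>.\<close>
  have "derivable rack_presentation m (App Act [?y, ?y])
      (App InvAct [t, App Act [t, App Act [?y, ?y]]])"
    using t y by (intro derive_sym[OF D(2)]) auto
  also have "derivable rack_presentation m \<dots>
      (App InvAct [t, App Act [App Act [t, ?y], App Act [t, ?y]]])"
    using D(3)[OF t y y] by (rule rack_cong[OF refl])
  also have "derivable rack_presentation m \<dots> (App InvAct [t, ?z])"
    using ty by (intro rack_cong refl)
  also have "derivable rack_presentation m \<dots> t"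
    using D(2) t t .
  finally show ?left .
  \<comment> \<open>Here the second \<open>t\<close> is written as \<open>t\<close> acting on
    \<open>?y\<close>; self-distributivity then turns the outer \<open>t\<close> into
    \<open>?z\<close>, and cancelling \<open>?z\<close> finishes.\<close>
  have "derivable rack_presentation m ?z (App Act [t, App Act [t, ?y]])"
    by (intro rack_cong refl derive_sym[OF ty])
  also have "derivable rack_presentation m \<dots> (App Act [?z, App Act [t, ?y]])"
    using D(3) t t y .
  also have "derivable rack_presentation m \<dots> (App Act [?z, t])"
    using ty by (rule rack_cong[OF derive_refl[OF z]])
  finally have "derivable rack_presentation m (App InvAct [?z, ?z])
      (App InvAct [?z, App Act [?z, t]])"
    by (rule rack_cong[OF derive_refl[OF z]])
  also have "derivable rack_presentation m \<dots> t"
    using D(2) z t .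
  finally show ?right .
qed

section \<open>The translations behind the two theory morphisms\<close>

fun can_op :: "perm_op \<Rightarrow> (rack_op, nat) trm" where
  "can_op Fwd = App Act [Var 0, Var 0]"
| "can_op Bwd = App InvAct [Var 0, Var 0]"

text \<open>Arguments are counted from 0, so \<open>Var 1\<close> is the point acted on, not the
  acting element.\<close>

fun per_op :: "rack_op \<Rightarrow> (perm_op, nat) trm" where
  "per_op Act = App Fwd [Var 1]"
| "per_op InvAct = App Bwd [Var 1]"

lemma translation_can: "translation perm_presentation rack_presentation can_op"
proof
  show "can_op f \<in> terms rack_presentation (arity perm_presentation f)" for f
    by (cases f) auto
  fix l r m and s :: "nat \<Rightarrow> (rack_op, nat) trm"
  assume "(l, r) \<in> equations perm_presentation"
    and "\<And>x. x \<in> vars l \<union> vars r \<Longrightarrow> s x \<in> terms rack_presentation m"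
  \<comment> \<open>Translated, the two equations are the two halves of
    \<open>rack_square_inverse\<close>.\<close>
  then show "derivable rack_presentation m (subst s (translate can_op l))
      (subst s (translate can_op r))"
    by (auto simp: perm_presentation_def Let_def intro!: rack_square_inverse)
qed

lemma translation_per: "translation rack_presentation perm_presentation per_op"
proof
  show "per_op f \<in> terms perm_presentation (arity rack_presentation f)" for f
    by (cases f) auto
  fix l r m and s :: "nat \<Rightarrow> (perm_op, nat) trm"
  assume "(l, r) \<in> equations rack_presentation"
    and "\<And>x. x \<in> vars l \<union> vars r \<Longrightarrow> s x \<in> terms perm_presentation m"
  \<comment> \<open>The inverse laws become the permutation equations; both sides of
    self-distributivity become \<open>App Fwd [App Fwd [s 2]]\<close>, so reflexivity
    suffices.\<close>
  then show "derivable perm_presentation m (subst s (translate per_op l))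
      (subst s (translate per_op r))"
    by (auto simp: rack_presentation_def Let_def intro!: perm_derivable derive_refl)
qed

text \<open>\<open>can_op\<close> doubles the single argument and \<open>per_op\<close> keeps the
  second copy, so the original term returns literally, not only up to derivability.\<close>

lemma translate_per_can:
  "t \<in> terms perm_presentation m \<Longrightarrow> translate per_op (translate can_op t) = t"
proof (induction rule: terms.induct)
  case (terms_App ts f)
  then show ?case by (cases f) (auto simp: length_Suc_conv)
qed simp

theorem proposition2p2:
  "\<exists>can per. lawvere_morphism Perm Rack can \<and> lawvere_morphism Rack Perm per \<and>
     morphism_eq Perm (comp_morphism per can) id_morphism"
proof (intro exI conjI)
  show "lawvere_morphism Perm Rack (translation_morphism rack_presentation can_op)"
    unfolding Perm_def Rack_def
    by (rule translation.lawvere_morphism_translation[OF translation_can])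
  show "lawvere_morphism Rack Perm (translation_morphism perm_presentation per_op)"
    unfolding Perm_def Rack_def
    by (rule translation.lawvere_morphism_translation[OF translation_per])
  show "morphism_eq Perm (comp_morphism (translation_morphism perm_presentation per_op)
      (translation_morphism rack_presentation can_op)) id_morphism"
    unfolding Perm_def
    by (rule translation_morphism_inverse[OF translation_can translation_per])
      (rule translate_per_can)
qed

end
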